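(* Let $N=2$, let $W$ be the $2\times2$ matrix with $W_{11}=W_{22}=7/8$ and $W_{12}=W_{21}=1/8$ (the two nodes are connected), let $R=\sqrt2$, $L=\sqrt2$, $G=10$, and let $c_0$ be an arbitrarily small positive number. Consider the standard distributed gradient method with step-size $\alpha_k=\frac{c}{(k+1)^\tau}$, $k=0,1,\dots$, where $\tau\ge0$ and $c\in[c_0,1/(2L)]$ are the degrees of freedom, and let $$\mathcal{E}(k,R;\tau,c)=\sup_{\{f_1,f_2\}\in\mathcal{F}(L,G)}\ \sup_{\overline{x}(0):\ \|\overline{x}(0)-x^\star\|\le R}\ \max_{i=1,2}\left\{f(x_i(k))-f^\star\right\}$$ be its worst-case optimality gap after $k$ iterations. Then $$\inf_{\tau\ge 0,\ c\in[c_0,\,1/(2L)]}\mathcal{E}(k,R;\tau,c)=\Omega\left(\frac{1}{k^{2/3}}\right),$$ i.e., $\liminf_{k\to\infty}k^{2/3}\inf_{\tau\ge0,\,c\in[c_0,1/(2L)]}\mathcal{E}(k,R;\tau,c)>0$.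
   Context: $\mathcal{F}(L,G)$ is the class of all pairs $\{f_1,f_2\}$ of functions $f_i:\mathbb{R}^d\to\mathbb{R}$ ($d$ is the generic dimension of the optimization variable) such that each $f_i$ is convex and differentiable, has Lipschitz continuous gradient with constant $L$, satisfies $\|\nabla f_i(x)\|\le G$ for all $x\in\mathbb{R}^d$, and $f=f_1+f_2$ attains its infimum $f^\star$ over $\mathbb{R}^d$ at some point $x^\star$. $\|\cdot\|$ is the Euclidean norm. Standard distributed gradient method: both nodes start at the same point $x_1(0)=x_2(0)=\overline{x}(0)$, and for $k=1,2,\dots$, $i=1,2$, $$x_i(k)=\sum_{j=1}^{2}W_{ij}\,x_j(k-1)-\alpha_{k-1}\nabla f_i(x_i(k-1)).$$ *)

theory Defs
  imports "HOL-Analysis.Analysis"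
begin

definition grad :: "('a::real_inner \<Rightarrow> real) \<Rightarrow> 'a \<Rightarrow> 'a" where
  "grad f x = (THE D. GDERIV f x :> D)"

text \<open>The two nodes are indexed by the type \<open>2\<close>, whose elements are \<open>1\<close> and \<open>2\<close>;
  a pair of costs is a function on that type.\<close>

definition total_cost :: "(2 \<Rightarrow> 'a \<Rightarrow> real) \<Rightarrow> 'a \<Rightarrow> real" where
  "total_cost f x = f 1 x + f 2 x"

definition minimizers :: "('a \<Rightarrow> real) \<Rightarrow> 'a set" where
  "minimizers f = {x. \<forall>y. f x \<le> f y}"

definition cost_class :: "real \<Rightarrow> real \<Rightarrow> (2 \<Rightarrow> real ^ 'd \<Rightarrow> real) set" where
  "cost_class L G =
    {f. (\<forall>i. convex_on UNIV (f i)
           \<and> (\<forall>x. f i differentiable (at x))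
           \<and> L-lipschitz_on UNIV (grad (f i))
           \<and> (\<forall>x. norm (grad (f i) x) \<le> G))
        \<and> minimizers (total_cost f) \<noteq> {}}"

primrec dist_grad ::
  "real ^ 2 ^ 2 \<Rightarrow> (nat \<Rightarrow> real) \<Rightarrow> (2 \<Rightarrow> real ^ 'd \<Rightarrow> real) \<Rightarrow> real ^ 'd \<Rightarrow> nat \<Rightarrow> 2 \<Rightarrow> real ^ 'd"
where
  "dist_grad W \<alpha> f x0 0 = (\<lambda>i. x0)"
| "dist_grad W \<alpha> f x0 (Suc k) =
     (\<lambda>i. (\<Sum>j\<in>UNIV. W $ i $ j *\<^sub>R dist_grad W \<alpha> f x0 k j)
          - \<alpha> k *\<^sub>R grad (f i) (dist_grad W \<alpha> f x0 k i))"

definition step_size :: "real \<Rightarrow> real \<Rightarrow> nat \<Rightarrow> real" where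
  "step_size \<tau> c k = c / (real k + 1) powr \<tau>"

text \<open>The first argument only carries the dimension \<open>CARD('d)\<close> of the optimization variable.
  The suprema are taken in the extended reals, so that no boundedness is presupposed.
  If \<open>f\<close> has several minimizers, each of them may serve as the reference point \<open>x\<^sup>*\<close>.\<close>

definition worst_case_gap ::
  "'d::finite itself \<Rightarrow> real ^ 2 ^ 2 \<Rightarrow> real \<Rightarrow> real \<Rightarrow> nat \<Rightarrow> real \<Rightarrow> real \<Rightarrow> real \<Rightarrow> ereal"
where
  "worst_case_gap _ W L G k R \<tau> c =
    (SUP f \<in> (cost_class L G :: (2 \<Rightarrow> real ^ 'd \<Rightarrow> real) set).
      SUP x0 \<in> {x0. \<exists>xs \<in> minimizers (total_cost f). norm (x0 - xs) \<le> R}.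
        ereal (MAX i. total_cost f (dist_grad W (step_size \<tau> c) f x0 k i)
                      - (INF x. total_cost f x)))"

end

theory Submission
  imports Defs
begin

text \<open>Two opposing effects balance at \<open>\<tau> = 1/3\<close>. For \<open>\<tau> \<le> 1/3\<close>, two Huber functions centred at
  \<open>1\<close> and \<open>-1\<close> keep the nodes apart: started at the minimizer \<open>0\<close> they move symmetrically to
  \<open>y\<close> and \<open>-y\<close> with \<open>y \<ge> \<alpha>\<^bsub>k-1\<^esub>\<close>, so the gap \<open>y\<^sup>2\<close> is at least of order \<open>k powr (-2\<tau>)\<close>.
  For \<open>\<tau> \<ge> 1/3\<close> the step sizes sum to at most \<open>k powr (2/3)\<close>, so on a common Huber function of
  curvature \<open>1/(2 k powr (2/3))\<close> the iterates cannot even halve their distance to the minimizer.\<close>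

section \<open>Huber functions on the real line\<close>

definition clip :: "real \<Rightarrow> real \<Rightarrow> real" where
  "clip M z = max (- M) (min M z)"

text \<open>Quadratic on \<open>[-M, M]\<close> and affine with slopes \<open>M\<close> and
  \<open>-M\<close> outside, for \<open>M \<ge> 0\<close>. Subtracting squared positive parts avoids
  a case distinction, so differentiability at the two junctions reduces to that of a single
  function.\<close>

definition huber :: "real \<Rightarrow> real \<Rightarrow> real" where
  "huber M z = z\<^sup>2 / 2 - (max 0 (z - M))\<^sup>2 / 2 - (max 0 (- z - M))\<^sup>2 / 2"

text \<open>In every sign case the first-order remainder is at most \<open>(y - x)\<^sup>2\<close>,
  so the difference quotient is within \<open>\<bar>y - x\<bar>\<close> of its limit, also at the
  kink \<open>x = 0\<close>.\<close>

lemma DERIV_positive_part_square: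
  "((\<lambda>x::real. (max 0 x)\<^sup>2 / 2) has_real_derivative max 0 x) (at x)"
proof -
  let ?g = "\<lambda>x::real. (max 0 x)\<^sup>2 / 2"
  have bound: "\<bar>(?g y - ?g x) / (y - x) - max 0 x\<bar> \<le> \<bar>y - x\<bar>" if "y \<noteq> x" for y
  proof -
    have "\<bar>?g y - ?g x - max 0 x * (y - x)\<bar> \<le> (y - x)\<^sup>2"
    proof (cases "x \<ge> 0"; cases "y \<ge> 0")
      assume "x \<ge> 0" "y \<ge> 0"
      then have "?g y - ?g x - max 0 x * (y - x) = (y - x)\<^sup>2 / 2"
        by (simp add: power2_eq_square field_simps)
      then show ?thesis
        using zero_le_power2[of "y - x"] by linarith
    next
      assume *: "x \<ge> 0" "\<not> y \<ge> 0"
      then have "?g y - ?g x - max 0 x * (y - x) = x\<^sup>2 / 2 - x * y"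
        by (simp add: power2_eq_square field_simps)
      moreover have "(y - x)\<^sup>2 = x\<^sup>2 - 2 * (x * y) + y\<^sup>2"
        by (simp add: power2_eq_square algebra_simps)
      moreover have "x * y \<le> 0"
        using * by (simp add: mult_nonneg_nonpos)
      ultimately show ?thesis
        using zero_le_power2[of x] zero_le_power2[of y] by linarith
    next
      assume *: "\<not> x \<ge> 0" "y \<ge> 0"
      then have "?g y - ?g x - max 0 x * (y - x) = y\<^sup>2 / 2"
        by simp
      moreover have "y\<^sup>2 \<le> (y - x)\<^sup>2"
        using * by (intro power_mono) auto
      ultimately show ?thesis
        using zero_le_power2[of y] by linarith
    qed auto
    moreover have "(?g y - ?g x) / (y - x) - max 0 x = (?g y - ?g x - max 0 x * (y - x)) / (y - x)"
      using that by (simp add: diff_divide_distrib)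
    ultimately show ?thesis
      using that by (simp add: abs_divide divide_le_eq power2_eq_square flip: abs_mult)
  qed
  have "((\<lambda>y. (?g y - ?g x) / (y - x) - max 0 x) \<longlongrightarrow> 0) (at x)"
  proof (rule Lim_null_comparison)
    show "\<forall>\<^sub>F y in at x. norm ((?g y - ?g x) / (y - x) - max 0 x) \<le> \<bar>y - x\<bar>"
      using bound by (auto simp: eventually_at intro!: exI[of _ 1])
    show "((\<lambda>y. \<bar>y - x\<bar>) \<longlongrightarrow> 0) (at x)"
      by (auto intro!: tendsto_eq_intros)
  qed
  then show ?thesis
    by (simp add: has_field_derivative_iff Lim_null[symmetric])
qed

text \<open>For \<open>M \<ge> 0\<close> at most one of the two positive parts is nonzero, and it
  cuts \<open>z\<close> back to \<open>M\<close> or \<open>-M\<close>.\<close>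

lemma DERIV_huber:
  assumes "M \<ge> 0"
  shows "(huber M has_real_derivative clip M z) (at z)"
proof -
  have "((\<lambda>z. z\<^sup>2 / 2 - (max 0 (z - M))\<^sup>2 / 2 - (max 0 (- z - M))\<^sup>2 / 2) has_real_derivative
      z - max 0 (z - M) * 1 - max 0 (- z - M) * (- 1)) (at z)"
    by (intro DERIV_diff DERIV_chain2[OF DERIV_positive_part_square])
       (auto intro!: derivative_eq_intros)
  moreover have "z - max 0 (z - M) * 1 - max 0 (- z - M) * (- 1) = clip M z"
    using assms by (auto simp: clip_def)
  ultimately show ?thesis
    by (simp add: huber_def[abs_def])
qed

lemma huber_eq: "\<bar>z\<bar> \<le> M \<Longrightarrow> huber M z = z\<^sup>2 / 2"
  by (auto simp: huber_def max_def abs_le_iff)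

lemma clip_eq: "\<bar>z\<bar> \<le> M \<Longrightarrow> clip M z = z"
  by (auto simp: clip_def)

lemma convex_on_huber:
  assumes "M \<ge> 0"
  shows "convex_on UNIV (huber M)"
  using assms by (intro convex_on_realI[where f' = "clip M"] DERIV_huber) (auto simp: clip_def)

lemma huber_above_tangent:
  assumes "M \<ge> 0"
  shows "huber M x + clip M x * (y - x) \<le> huber M y"
  using convex_on_imp_above_tangent[OF convex_on_huber[OF assms], of x y "clip M x"]
    DERIV_huber[OF assms, of x]
  by simp

section \<open>Huber ridges in arbitrary dimension\<close>

text \<open>Varying only along \<open>e\<close> carries the scalar examples to every dimension. For
  a unit vector \<open>e\<close>, \<open>\<epsilon>\<close> is the curvature and \<open>b\<close>
  the centre along \<open>e\<close>.\<close>

definition ridge :: "real \<Rightarrow> real \<Rightarrow> 'a::real_inner \<Rightarrow> real \<Rightarrow> 'a \<Rightarrow> real" where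
  "ridge M \<epsilon> e b x = \<epsilon> * huber M (x \<bullet> e - b)"

lemma GDERIV_ridge:
  assumes "M \<ge> 0"
  shows "GDERIV (ridge M \<epsilon> e b) x :> (\<epsilon> * clip M (x \<bullet> e - b)) *\<^sub>R e"
proof -
  have "((\<lambda>x. huber M (x \<bullet> e - b)) has_derivative (\<lambda>h. h \<bullet> e * clip M (x \<bullet> e - b))) (at x)"
    by (rule DERIV_compose_FDERIV[OF DERIV_huber[OF assms]])
       (auto intro!: derivative_eq_intros)
  from has_derivative_mult_right[OF this, of \<epsilon>] show ?thesis
    by (simp add: gderiv_def ridge_def[abs_def] mult_ac)
qed

text \<open>Since \<open>grad\<close> is a definite description, uniqueness is required: two
  candidates represent the same derivative, and evaluating it at their difference shows that the
  difference has norm zero.\<close>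

lemma grad_eqI:
  assumes "GDERIV f x :> D"
  shows "grad f x = D"
proof -
  have "D' = D" if "GDERIV f x :> D'" for D'
  proof -
    have "(\<lambda>h. h \<bullet> D') = (\<lambda>h. h \<bullet> D)"
      using that assms has_derivative_unique unfolding gderiv_def by blast
    then have "(D' - D) \<bullet> (D' - D) = 0"
      by (metis inner_diff_right right_minus_eq)
    then show ?thesis by simp
  qed
  then show ?thesis
    unfolding grad_def using assms by blast
qed

lemmas grad_ridge = grad_eqI[OF GDERIV_ridge]

lemma convex_on_ridge:
  assumes "M \<ge> 0" "\<epsilon> \<ge> 0"
  shows "convex_on UNIV (ridge M \<epsilon> e b)"
proof (rule convex_onI)
  fix t x y assume t: "0 < t" "t < (1::real)"
  have "huber M (((1 - t) *\<^sub>R x + t *\<^sub>R y) \<bullet> e - b)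
      = huber M ((1 - t) *\<^sub>R (x \<bullet> e - b) + t *\<^sub>R (y \<bullet> e - b))"
    by (simp add: inner_add_left algebra_simps)
  also have "\<dots> \<le> (1 - t) * huber M (x \<bullet> e - b) + t * huber M (y \<bullet> e - b)"
    using convex_onD[OF convex_on_huber[OF assms(1)]] t by simp
  finally show "ridge M \<epsilon> e b ((1 - t) *\<^sub>R x + t *\<^sub>R y)
      \<le> (1 - t) * ridge M \<epsilon> e b x + t * ridge M \<epsilon> e b y"
    using mult_left_mono[OF _ assms(2)] by (fastforce simp: ridge_def algebra_simps)
qed simp

text \<open>Clipping is 1-Lipschitz, and so is taking the inner product with a unit vector.\<close>

lemma grad_ridge_lipschitz:
  assumes "M \<ge> 0" "0 \<le> \<epsilon>" "\<epsilon> \<le> L" "norm e = 1"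
  shows "L-lipschitz_on UNIV (grad (ridge M \<epsilon> e b))"
proof (rule lipschitz_onI)
  fix x y
  have "dist (grad (ridge M \<epsilon> e b) x) (grad (ridge M \<epsilon> e b) y)
      = \<epsilon> * \<bar>clip M (x \<bullet> e - b) - clip M (y \<bullet> e - b)\<bar>"
    using assms by (simp add: grad_ridge dist_norm abs_mult
        flip: scaleR_left_diff_distrib right_diff_distrib)
  also have "\<dots> \<le> \<epsilon> * \<bar>(x - y) \<bullet> e\<bar>"
    using assms(2) by (intro mult_left_mono) (auto simp: clip_def inner_diff_left)
  also have "\<dots> \<le> L * dist x y"
    using assms Cauchy_Schwarz_ineq2[of "x - y" e] by (intro mult_mono) (auto simp: dist_norm)
  finally show "dist (grad (ridge M \<epsilon> e b) x) (grad (ridge M \<epsilon> e b) y) \<le> L * dist x y" .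
qed (use assms in simp)

section \<open>Pairs of ridges as admissible costs\<close>

text \<open>One family serves both regimes: \<open>a = 1\<close> gives opposing costs,
  \<open>a = 0\<close> two identical ones.\<close>

definition ridge_pair :: "real \<Rightarrow> real \<Rightarrow> 'a::real_inner \<Rightarrow> real \<Rightarrow> 2 \<Rightarrow> 'a \<Rightarrow> real" where
  "ridge_pair M \<epsilon> e a i = ridge M \<epsilon> e (if i = 1 then a else - a)"

lemma ridge_pair_simps:
  "ridge_pair M \<epsilon> e a 1 = ridge M \<epsilon> e a" "ridge_pair M \<epsilon> e a 2 = ridge M \<epsilon> e (- a)"
  by (simp_all add: ridge_pair_def)

text \<open>The tangents at \<open>0\<close> have opposite slopes \<open>-a\<close> and
  \<open>a\<close>, unclipped because \<open>\<bar>a\<bar> \<le> M\<close>; adding the two tangent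
  inequalities cancels the linear terms.\<close>

lemma zero_in_minimizers_ridge_pair:
  assumes "\<bar>a\<bar> \<le> M" "\<epsilon> \<ge> 0"
  shows "0 \<in> minimizers (total_cost (ridge_pair M \<epsilon> e a))"
  unfolding minimizers_def
proof safe
  fix x :: 'a
  have "M \<ge> 0" using assms by simp
  then have "huber M (- a) - a * (x \<bullet> e) \<le> huber M (x \<bullet> e - a)"
    "huber M a + a * (x \<bullet> e) \<le> huber M (x \<bullet> e + a)"
    using huber_above_tangent[of M "- a" "x \<bullet> e - a"] huber_above_tangent[of M a "x \<bullet> e + a"] assms
    by (simp_all add: clip_eq)
  then have "huber M (- a) + huber M a \<le> huber M (x \<bullet> e - a) + huber M (x \<bullet> e + a)"
    by simp
  from mult_left_mono[OF this assms(2)]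
  show "total_cost (ridge_pair M \<epsilon> e a) 0 \<le> total_cost (ridge_pair M \<epsilon> e a) x"
    by (simp add: total_cost_def ridge_pair_simps ridge_def algebra_simps)
qed

lemma ridge_pair_in_cost_class:
  fixes e :: "real ^ 'd"
  assumes "\<bar>a\<bar> \<le> M" "0 \<le> \<epsilon>" "\<epsilon> \<le> L" "\<epsilon> * M \<le> G" "norm e = 1"
  shows "ridge_pair M \<epsilon> e a \<in> cost_class L G"
proof -
  have M: "M \<ge> 0" using assms by simp
  have "norm (grad (ridge M \<epsilon> e b) x) \<le> G" for b x
  proof -
    have "\<epsilon> * \<bar>clip M (x \<bullet> e - b)\<bar> \<le> \<epsilon> * M"
      using assms M by (intro mult_left_mono) (auto simp: clip_def)
    then show ?thesis
      using assms M by (simp add: grad_ridge abs_mult)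
  qed
  moreover have "ridge M \<epsilon> e b differentiable (at x)" for b x
    using GDERIV_ridge[OF M] unfolding gderiv_def differentiable_def by blast
  moreover have "minimizers (total_cost (ridge_pair M \<epsilon> e a)) \<noteq> {}"
    using zero_in_minimizers_ridge_pair[OF assms(1,2)] by blast
  ultimately show ?thesis
    using assms M by (auto simp: cost_class_def ridge_pair_def convex_on_ridge grad_ridge_lipschitz)
qed

text \<open>Both Huber arguments stay in the quadratic zone and the cross terms in
  \<open>a * s\<close> cancel, so the gap does not depend on \<open>a\<close>.\<close>

lemma total_cost_ridge_pair_gap:
  assumes "\<bar>s\<bar> + \<bar>a\<bar> \<le> M" "norm e = 1"
  shows "total_cost (ridge_pair M \<epsilon> e a) (s *\<^sub>R e) - total_cost (ridge_pair M \<epsilon> e a) 0 = \<epsilon> * s\<^sup>2"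
proof -
  have "e \<bullet> e = 1" using assms(2) by (simp add: dot_square_norm)
  moreover have "huber M (s - a) = (s - a)\<^sup>2 / 2" "huber M (s + a) = (s + a)\<^sup>2 / 2"
    "huber M (- a) = a\<^sup>2 / 2" "huber M a = a\<^sup>2 / 2"
    using assms(1) by (subst huber_eq; auto)+
  moreover have "(s - a)\<^sup>2 / 2 + (s + a)\<^sup>2 / 2 - (a\<^sup>2 / 2 + a\<^sup>2 / 2) = s\<^sup>2"
    by (simp add: power2_eq_square field_simps)
  ultimately show ?thesis
    by (simp add: total_cost_def ridge_pair_simps ridge_def flip: distrib_left right_diff_distrib)
qed

text \<open>A single instance bounds the supremum from below, and the infimum in the gap is attained
  at \<open>xs\<close>.\<close>

lemma worst_case_gap_ge:
  fixes f :: "2 \<Rightarrow> real ^ 'd \<Rightarrow> real"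
  assumes "f \<in> cost_class L G" "xs \<in> minimizers (total_cost f)" "norm (x0 - xs) \<le> R"
  shows "ereal (total_cost f (dist_grad W (step_size \<tau> c) f x0 k i) - total_cost f xs)
    \<le> worst_case_gap TYPE('d) W L G k R \<tau> c"
proof -
  let ?gap = "\<lambda>i. total_cost f (dist_grad W (step_size \<tau> c) f x0 k i) - (INF x. total_cost f x)"
  have "(INF x. total_cost f x) = total_cost f xs"
    using assms(2) by (intro cInf_eq_minimum) (auto simp: minimizers_def)
  then have "ereal (total_cost f (dist_grad W (step_size \<tau> c) f x0 k i) - total_cost f xs)
      \<le> ereal (MAX i. ?gap i)"
    by simp
  also have "\<dots> \<le> worst_case_gap TYPE('d) W L G k R \<tau> c"
    unfolding worst_case_gap_def
    by (rule SUP_upper2[OF assms(1)], rule SUP_upper) (use assms(2,3) in auto)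
  finally show ?thesis .
qed

section \<open>Explicit trajectories of the method\<close>

text \<open>The configuration \<open>y\<close>, \<open>-y\<close> is preserved, and each gradient
  step pushes the nodes apart again. The bound \<open>y \<le> 1\<close> keeps both nodes where
  clipping is inactive. The last conjunct is conditional because no step precedes iterate
  \<open>0\<close>.\<close>

lemma dist_grad_opposing:
  fixes W :: "real ^ 2 ^ 2" and e :: "real ^ 'd"
  assumes W: "W $ 1 $ 1 = 7/8" "W $ 2 $ 2 = 7/8" "W $ 1 $ 2 = 1/8" "W $ 2 $ 1 = 1/8"
    and e: "norm e = 1" and \<alpha>: "\<And>t. 0 \<le> \<alpha> t \<and> \<alpha> t \<le> 3/4"
  shows "\<exists>y. dist_grad W \<alpha> (ridge_pair 2 1 e 1) 0 k 1 = y *\<^sub>R e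
    \<and> dist_grad W \<alpha> (ridge_pair 2 1 e 1) 0 k 2 = (- y) *\<^sub>R e
    \<and> 0 \<le> y \<and> y \<le> 1 \<and> (\<forall>t. k = Suc t \<longrightarrow> \<alpha> t \<le> y)"
proof (induction k)
  case 0
  show ?case by (intro exI[of _ 0]) simp
next
  case (Suc k)
  then obtain y where
    y1: "dist_grad W \<alpha> (ridge_pair 2 1 e 1) 0 k 1 = y *\<^sub>R e" and
    y2: "dist_grad W \<alpha> (ridge_pair 2 1 e 1) 0 k 2 = (- y) *\<^sub>R e" and y: "0 \<le> y" "y \<le> 1"
    by blast
  \<comment> \<open>Averaging \<open>y\<close> with \<open>-y\<close> contracts by
    \<open>7/8 - 1/8 = 3/4\<close>, and the gradient step adds \<open>\<alpha> k * (1 - y)\<close>.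
    Since \<open>\<alpha> k \<le> 3/4\<close>, the coefficient of \<open>y\<close> is nonnegative,
    whence \<open>\<alpha> k \<le> y'\<close>.\<close>
  define y' where "y' = (3/4 - \<alpha> k) * y + \<alpha> k"
  have ee: "e \<bullet> e = 1" using e by (simp add: dot_square_norm)
  have g: "grad (ridge_pair 2 1 e 1 1) (y *\<^sub>R e) = (y - 1) *\<^sub>R e"
    "grad (ridge_pair 2 1 e 1 2) ((- y) *\<^sub>R e) = (1 - y) *\<^sub>R e"
    using y ee by (simp_all add: ridge_pair_simps grad_ridge clip_eq)
  have "dist_grad W \<alpha> (ridge_pair 2 1 e 1) 0 (Suc k) 1 = y' *\<^sub>R e"
    "dist_grad W \<alpha> (ridge_pair 2 1 e 1) 0 (Suc k) 2 = (- y') *\<^sub>R e"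
    unfolding dist_grad.simps sum_2 y1 y2 g W y'_def by (simp_all add: vec_eq_iff algebra_simps)
  moreover have "\<alpha> k \<le> y'" "0 \<le> y'"
    using \<alpha>[of k] y by (simp_all add: y'_def)
  moreover have "(3/4 - \<alpha> k) * y \<le> (3/4 - \<alpha> k) * 1"
    using \<alpha>[of k] y by (intro mult_left_mono) auto
  then have "y' \<le> 1" by (simp add: y'_def)
  ultimately show ?case by blast
qed

text \<open>With equal costs and row sums 1 the nodes never separate, so this is plain gradient
  descent on a quadratic: step \<open>t\<close> multiplies \<open>p\<close> by
  \<open>1 - \<alpha> t * \<epsilon>\<close>. As \<open>p \<le> 1\<close>, it loses at most
  \<open>\<alpha> t * \<epsilon>\<close>.\<close>

lemma dist_grad_common:
  fixes W :: "real ^ 2 ^ 2" and e :: "real ^ 'd"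
  assumes W: "\<And>i. W $ i $ 1 + W $ i $ 2 = 1"
    and e: "norm e = 1" and \<alpha>: "\<And>t. 0 \<le> \<alpha> t \<and> \<alpha> t \<le> 1" and \<epsilon>: "0 \<le> \<epsilon>" "\<epsilon> \<le> 1"
  shows "\<exists>p. (\<forall>i. dist_grad W \<alpha> (ridge_pair 1 \<epsilon> e 0) e k i = p *\<^sub>R e)
    \<and> 0 \<le> p \<and> p \<le> 1 \<and> 1 - \<epsilon> * (\<Sum>t<k. \<alpha> t) \<le> p"
proof (induction k)
  case 0
  show ?case by (intro exI[of _ 1]) simp
next
  case (Suc k)
  then obtain p where p: "\<And>i. dist_grad W \<alpha> (ridge_pair 1 \<epsilon> e 0) e k i = p *\<^sub>R e"
    "0 \<le> p" "p \<le> 1" "1 - \<epsilon> * (\<Sum>t<k. \<alpha> t) \<le> p"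
    by blast
  define p' where "p' = (1 - \<alpha> k * \<epsilon>) * p"
  have ee: "e \<bullet> e = 1" using e by (simp add: dot_square_norm)
  have g: "grad (ridge_pair 1 \<epsilon> e 0 i) (p *\<^sub>R e) = (\<epsilon> * p) *\<^sub>R e" for i
    using p ee by (simp add: ridge_pair_def grad_ridge clip_eq)
  have W2: "W $ i $ 2 = 1 - W $ i $ 1" for i
    using W[of i] by simp
  have "dist_grad W \<alpha> (ridge_pair 1 \<epsilon> e 0) e (Suc k) i = p' *\<^sub>R e" for i
    unfolding dist_grad.simps sum_2 p(1) g W2 p'_def by (simp add: algebra_simps)
  moreover have "0 \<le> \<alpha> k * \<epsilon>" "\<alpha> k * \<epsilon> \<le> 1"
    using \<alpha>[of k] \<epsilon> by (auto intro: mult_le_one)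
  then have "0 \<le> p'" "p' \<le> 1" "\<alpha> k * \<epsilon> * p \<le> \<alpha> k * \<epsilon>"
    using p by (auto simp: p'_def intro: mult_le_one mult_left_le)
  moreover from this have "1 - \<epsilon> * (\<Sum>t<Suc k. \<alpha> t) \<le> p'"
    using p(4) by (simp add: p'_def algebra_simps)
  ultimately show ?case by blast
qed

section \<open>Growth of the accumulated step sizes\<close>

text \<open>Comparison with an integral would give the factor \<open>3/2\<close>; the weaker factor
  \<open>2\<close> reduces the induction step to a polynomial inequality in the cube roots
  \<open>u\<close>, \<open>v\<close> of consecutive integers.\<close>

lemma sum_inverse_cube_root_le:
  "(\<Sum>t<n. 1 / (real t + 1) powr (1/3)) \<le> 2 * real n powr (2/3)"
proof (induction n)
  case (Suc n)
  define u v where "u = real n powr (1/3)" and "v = real (Suc n) powr (1/3)"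
  have uv: "0 \<le> u" "u \<le> v" "0 < v"
    by (auto simp: u_def v_def intro: powr_mono2)
  have cube: "u ^ 3 = real n" "v ^ 3 = real (Suc n)"
    by (auto simp: u_def v_def powr_powr simp flip: powr_numeral)
  have square: "u\<^sup>2 = real n powr (2/3)" "v\<^sup>2 = real (Suc n) powr (2/3)"
    by (auto simp: u_def v_def powr_powr simp flip: powr_numeral)
  \<comment> \<open>With \<open>v ^ 3 - u ^ 3 = 1\<close>, this is the required
    \<open>1 / v \<le> 2 * v\<^sup>2 - 2 * u\<^sup>2\<close> multiplied by \<open>v\<close>, in
    factored form.\<close>
  have "0 \<le> (v - u) * (v * v + u * (v - u))"
    using uv by (intro mult_nonneg_nonneg add_nonneg_nonneg) auto
  also have "\<dots> = 2 * (v * v\<^sup>2) - 2 * (v * u\<^sup>2) - (v ^ 3 - u ^ 3)"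
    by (simp add: power2_eq_square power3_eq_cube algebra_simps)
  finally have "1 \<le> (2 * v\<^sup>2 - 2 * u\<^sup>2) * v"
    using cube by (simp add: algebra_simps)
  then have "1 / v \<le> 2 * v\<^sup>2 - 2 * u\<^sup>2"
    using uv by (simp only: pos_divide_le_eq)
  then have "1 / (real n + 1) powr (1/3) \<le> 2 * real (Suc n) powr (2/3) - 2 * real n powr (2/3)"
    unfolding square by (simp add: v_def add.commute)
  with Suc show ?case
    by simp
qed simp

section \<open>The lower bound of order \<open>k powr (-2/3)\<close>\<close>

theorem mainTheorem5:
  fixes W :: "real ^ 2 ^ 2" and R L G c0 :: real
  assumes "W $ 1 $ 1 = 7/8" and "W $ 2 $ 2 = 7/8" and "W $ 1 $ 2 = 1/8" and "W $ 2 $ 1 = 1/8"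
    and "R = sqrt 2" and "L = sqrt 2" and "G = 10" and "c0 > 0"
  shows "liminf (\<lambda>k. ereal (real k powr (2/3)) *
           (INF (\<tau>, c) \<in> {0..} \<times> {c0..1 / (2 * L)}.
              worst_case_gap TYPE('d::finite) W L G k R \<tau> c)) > 0"
proof -
  obtain e :: "real ^ 'd" where e: "norm e = 1"
    using vector_choose_size[of 1] by auto
  \<comment> \<open>\<open>c0\<^sup>2\<close> comes from the opposing pair; \<open>1/8\<close> is
    the curvature factor \<open>1/2\<close> times the square of the remaining distance
    \<open>1/2\<close> for the common pair.\<close>
  define \<delta> where "\<delta> = min (1/8) (c0\<^sup>2)"
  have \<delta>: "\<delta> > 0" using assms(8) by (simp add: \<delta>_def)
  have L: "1 \<le> L" "0 \<le> R" "1 \<le> R" using assms by auto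
  \<comment> \<open>The constant \<open>\<delta>\<close> depends on neither \<open>\<tau>\<close>
    nor \<open>c\<close>, so the bound survives the infimum over both.\<close>
  have gap: "ereal (\<delta> / real k powr (2/3)) \<le> worst_case_gap TYPE('d) W L G k R \<tau> c"
    if k: "k \<ge> 1" and \<tau>: "\<tau> \<ge> 0" and c: "c0 \<le> c" "c \<le> 1 / (2 * L)" for k \<tau> c
  proof -
    have "1 / (2 * L) \<le> 1 / 2"
      using L by (simp add: field_simps)
    then have c': "0 < c" "c \<le> 1/2"
      using c assms(8) by linarith+
    \<comment> \<open>The bound \<open>1/2\<close> lies below the limits \<open>3/4\<close> and
      \<open>1\<close> imposed by the two trajectory lemmas.\<close>
    have \<alpha>: "0 \<le> step_size \<tau> c t \<and> step_size \<tau> c t \<le> 1/2" for t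
    proof -
      have "1 \<le> (real t + 1) powr \<tau>"
        using \<tau> by (intro ge_one_powr_ge_zero) auto
      then have "c / (real t + 1) powr \<tau> \<le> c / 1"
        using c' by (intro divide_left_mono) auto
      then show ?thesis
        unfolding step_size_def div_by_1 using c'
        by (meson divide_nonneg_nonneg less_imp_le order_trans powr_ge_zero)
    qed
    show ?thesis
    proof (cases "\<tau> \<le> 1/3")
      case True
      \<comment> \<open>Iterate \<open>k\<close> is produced with step size number
        \<open>k - 1\<close>, which equals exactly \<open>c / real k powr \<tau>\<close>.\<close>
      obtain t where t: "k = Suc t" using k by (cases k) auto
      have \<alpha>': "0 \<le> step_size \<tau> c t \<and> step_size \<tau> c t \<le> 3/4" for t
        using \<alpha>[of t] by linarith
      obtain y where y: "dist_grad W (step_size \<tau> c) (ridge_pair 2 1 e 1) 0 k 1 = y *\<^sub>R e"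
        "0 \<le> y" "y \<le> 1" "step_size \<tau> c t \<le> y"
        using dist_grad_opposing[where \<alpha> = "step_size \<tau> c" and k = k, OF assms(1-4) e \<alpha>'] t by blast
      have "c0 / real k powr (1/3) \<le> c / real k powr \<tau>"
        using c c' k True by (intro frac_le powr_mono) auto
      also have "\<dots> \<le> y"
        using y(4) by (simp add: step_size_def t add.commute)
      finally have "(c0 / real k powr (1/3))\<^sup>2 \<le> y\<^sup>2"
        using assms(8) by (intro power_mono) auto
      moreover have "(real k powr (1/3))\<^sup>2 = real k powr (2/3)"
        by (simp add: powr_powr flip: powr_numeral)
      moreover have "\<delta> / real k powr (2/3) \<le> c0\<^sup>2 / real k powr (2/3)"
        by (intro divide_right_mono) (auto simp: \<delta>_def)
      ultimately have "\<delta> / real k powr (2/3) \<le> y\<^sup>2"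
        by (simp add: power_divide)
      moreover have "ereal (y\<^sup>2) \<le> worst_case_gap TYPE('d) W L G k R \<tau> c"
      proof -
        have "ridge_pair 2 1 e 1 \<in> cost_class L G"
          using e L assms(7) by (intro ridge_pair_in_cost_class) auto
        moreover have "0 \<in> minimizers (total_cost (ridge_pair 2 1 e 1))"
          by (intro zero_in_minimizers_ridge_pair) auto
        ultimately have "ereal (total_cost (ridge_pair 2 1 e 1) (y *\<^sub>R e) - total_cost (ridge_pair 2 1 e 1) 0)
            \<le> worst_case_gap TYPE('d) W L G k R \<tau> c"
          unfolding y(1)[symmetric] by (rule worst_case_gap_ge) (use L in simp)
        then show ?thesis
          using y e by (simp add: total_cost_ridge_pair_gap)
      qed
      ultimately show ?thesis
        by (meson ereal_less_eq(3) order_trans)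
    next
      case False
      \<comment> \<open>The accumulated step size will be at most \<open>real k powr (2/3)\<close>;
        this curvature makes the total loss at most \<open>1/2\<close>. The costs may vary with
        \<open>k\<close>, since the supremum is taken for each \<open>k\<close> separately.\<close>
      define \<epsilon> where "\<epsilon> = 1 / (2 * real k powr (2/3))"
      have pos: "1 \<le> real k powr (2/3)"
        using k by (intro ge_one_powr_ge_zero) auto
      have \<epsilon>: "0 \<le> \<epsilon>" "\<epsilon> \<le> 1"
        unfolding \<epsilon>_def using pos frac_le[of 1 1 1 "2 * real k powr (2/3)"] by simp_all
      have \<alpha>': "0 \<le> step_size \<tau> c t \<and> step_size \<tau> c t \<le> 1" for t
        using \<alpha>[of t] by linarith
      have "W $ i $ 1 + W $ i $ 2 = 1" for i
        using assms(1-4) exhaust_2[of i] by auto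
      then obtain p where p: "dist_grad W (step_size \<tau> c) (ridge_pair 1 \<epsilon> e 0) e k 1 = p *\<^sub>R e"
        "0 \<le> p" "p \<le> 1" "1 - \<epsilon> * (\<Sum>t<k. step_size \<tau> c t) \<le> p"
        using dist_grad_common[where W = W and \<alpha> = "step_size \<tau> c" and k = k, OF _ e \<alpha>' \<epsilon>] by blast
      \<comment> \<open>The factor \<open>1/2\<close> from \<open>c \<le> 1/2\<close> cancels the
        \<open>2\<close> in the bound on the sum of inverse cube roots.\<close>
      have "c / (real t + 1) powr \<tau> \<le> (1/2) / (real t + 1) powr (1/3)" for t
        using c' False by (intro frac_le powr_mono) auto
      then have "step_size \<tau> c t \<le> (1/2) * (1 / (real t + 1) powr (1/3))" for t
        by (simp add: step_size_def)
      then have "(\<Sum>t<k. step_size \<tau> c t) \<le> (1/2) * (\<Sum>t<k. 1 / (real t + 1) powr (1/3))"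
        by (simp only: sum_distrib_left sum_mono)
      also have "\<dots> \<le> real k powr (2/3)"
        using sum_inverse_cube_root_le[of k] by simp
      finally have "\<epsilon> * (\<Sum>t<k. step_size \<tau> c t) \<le> \<epsilon> * real k powr (2/3)"
        using \<epsilon> by (intro mult_left_mono) auto
      also have "\<dots> = 1/2"
        using k by (simp add: \<epsilon>_def)
      finally have "1/2 \<le> p" using p(4) by linarith
      then have "\<epsilon> * (1/2)\<^sup>2 \<le> \<epsilon> * p\<^sup>2"
        using \<epsilon> by (intro mult_left_mono power_mono) auto
      moreover have "\<delta> / real k powr (2/3) \<le> (1/8) / real k powr (2/3)"
        by (intro divide_right_mono) (auto simp: \<delta>_def)
      ultimately have "\<delta> / real k powr (2/3) \<le> \<epsilon> * p\<^sup>2"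
        by (simp add: \<epsilon>_def power2_eq_square)
      moreover have "ereal (\<epsilon> * p\<^sup>2) \<le> worst_case_gap TYPE('d) W L G k R \<tau> c"
      proof -
        have "ridge_pair 1 \<epsilon> e 0 \<in> cost_class L G"
          using e L \<epsilon> assms(7) by (intro ridge_pair_in_cost_class) auto
        moreover have "0 \<in> minimizers (total_cost (ridge_pair 1 \<epsilon> e 0))"
          using \<epsilon> by (intro zero_in_minimizers_ridge_pair) auto
        ultimately have "ereal (total_cost (ridge_pair 1 \<epsilon> e 0) (p *\<^sub>R e) - total_cost (ridge_pair 1 \<epsilon> e 0) 0)
            \<le> worst_case_gap TYPE('d) W L G k R \<tau> c"
          unfolding p(1)[symmetric] by (rule worst_case_gap_ge) (use L e in simp)
        then show ?thesis
          using p e by (simp add: total_cost_ridge_pair_gap)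
      qed
      ultimately show ?thesis
        by (meson ereal_less_eq(3) order_trans)
    qed
  qed
  \<comment> \<open>Only \<open>k \<ge> 1\<close> is claimed: at \<open>k = 0\<close> the factor
    \<open>real k powr (2/3)\<close> is zero.\<close>
  have "\<forall>\<^sub>F k in sequentially. ereal \<delta> \<le> ereal (real k powr (2/3)) *
      (INF (\<tau>, c) \<in> {0..} \<times> {c0..1 / (2 * L)}. worst_case_gap TYPE('d) W L G k R \<tau> c)"
    using eventually_ge_at_top[of 1]
  proof eventually_elim
    case (elim k)
    have "ereal \<delta> = ereal (real k powr (2/3)) * ereal (\<delta> / real k powr (2/3))"
      using elim by simp
    also have "\<dots> \<le> ereal (real k powr (2/3)) *
        (INF (\<tau>, c) \<in> {0..} \<times> {c0..1 / (2 * L)}. worst_case_gap TYPE('d) W L G k R \<tau> c)"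
      using gap[OF elim] by (intro ereal_mult_left_mono INF_greatest) auto
    finally show ?case .
  qed
  then have "ereal \<delta> \<le> liminf (\<lambda>k. ereal (real k powr (2/3)) *
      (INF (\<tau>, c) \<in> {0..} \<times> {c0..1 / (2 * L)}. worst_case_gap TYPE('d) W L G k R \<tau> c))"
    by (rule Liminf_bounded)
  with \<delta> show ?thesis
    by (simp add: less_le_trans[of 0 "ereal \<delta>"])
qed

end
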